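(* For every positive integer $n$, there exists an edge coloring of the complete graph $K_n$ with $2^{6\sqrt{\log n}}$ colors such that for every set $X$ of colors with $|X|\ge 2$, the subgraph of $K_n$ formed by the edges whose color lies in $X$ has chromatic number at most $2^{3\sqrt{|X|\log|X|}}$.
   Context: Logarithms are base 2; the number of colors $2^{6\sqrt{\log n}}$ is understood up to rounding (the paper omits floor and ceiling signs). *)

theory Defs
  imports Complex_Main
begin

definition proper_colouring :: "'a set \<Rightarrow> ('a \<Rightarrow> 'a \<Rightarrow> bool) \<Rightarrow> nat \<Rightarrow> ('a \<Rightarrow> nat) \<Rightarrow> bool" where
  "proper_colouring V E k f \<longleftrightarrow>
     (\<forall>v\<in>V. f v < k) \<and> (\<forall>u\<in>V. \<forall>v\<in>V. E u v \<longrightarrow> f u \<noteq> f v)"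

definition chromatic_number :: "'a set \<Rightarrow> ('a \<Rightarrow> 'a \<Rightarrow> bool) \<Rightarrow> nat" where
  "chromatic_number V E = (LEAST k. \<exists>f. proper_colouring V E k f)"

end

theory Submission
  imports Defs "HOL-Library.FuncSet"
begin

text \<open>Vertices are coded as words of length \<open>t = \<lceil>sqrt (log n)\<rceil>\<close> over an alphabet of size \<open>2 ^ t\<close>,
  and, following Mubayi, the edge \<open>{x, y}\<close> gets as its colour the set of coordinates where \<open>x\<close>
  and \<open>y\<close> differ together with the unordered pair of letters at the first of them, its leading
  coordinate. That is at most \<open>2 ^ (3 * t)\<close> colours.

  Given \<open>s\<close> colours, let \<open>D = \<lfloor>sqrt (s * log s)\<rfloor>\<close>. If every leading coordinate lies in at most \<open>D\<close> of
  the difference sets, the colours split into \<open>D\<close> classes each of which spans a bipartite graph,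
  so \<open>2 ^ D\<close> vertex colours suffice. Otherwise split the vertices according to a letter, among the
  at most \<open>2 * s\<close> relevant ones, that they carry at a coordinate lying in more than \<open>D\<close> difference
  sets: inside each part at least \<open>D + 1\<close> colours disappear, so this recursion has depth at most
  \<open>s div (D + 1)\<close> and costs a factor \<open>2 * s + 1\<close> per level.\<close>

text \<open>Lets the constructions below use structured values, such as sets of classes or tagged
  pairs, as colours; an injection turns them into numbers below \<open>k\<close>.\<close>

lemma proper_colouringI_card:
  assumes "finite C" "card C \<le> k" "f ` V \<subseteq> C"
    and "\<And>u v. u \<in> V \<Longrightarrow> v \<in> V \<Longrightarrow> E u v \<Longrightarrow> f u \<noteq> f v"
  shows "\<exists>g. proper_colouring V E k g"
proof -
  obtain h where h: "h ` C \<subseteq> {..<k}" "inj_on h C"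
    using card_le_inj[of C "{..<k}"] assms(1,2) by auto
  have "proper_colouring V E k (h \<circ> f)"
    unfolding proper_colouring_def
  proof (intro conjI ballI impI)
    fix v assume "v \<in> V" then show "(h \<circ> f) v < k" using assms(3) h(1) by auto
  next
    fix u v assume uv: "u \<in> V" "v \<in> V" "E u v"
    then have "f u \<noteq> f v" "f u \<in> C" "f v \<in> C" using assms(3,4) by auto
    then show "(h \<circ> f) u \<noteq> (h \<circ> f) v" using h(2) by (auto dest: inj_onD)
  qed
  then show ?thesis by blast
qed

lemma chromatic_number_le:
  assumes "proper_colouring V E k f"
  shows "chromatic_number V E \<le> k"
  unfolding chromatic_number_def by (rule Least_le) (use assms in blast)

section \<open>The edge colouring of words and its leading coordinates\<close>

definition diff_set :: "(nat \<Rightarrow> 'b) set \<Rightarrow> nat set" where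
  "diff_set e = {j. \<exists>x\<in>e. \<exists>y\<in>e. x j \<noteq> y j}"

text \<open>Taking the edge as a set \<open>e\<close> makes the colour independent of the order of
  the endpoints. For distinct endpoints, \<open>Inf\<close> is the minimum of a nonempty
  set.\<close>

definition mubayi :: "(nat \<Rightarrow> 'b) set \<Rightarrow> nat set \<times> 'b set" where
  "mubayi e = (diff_set e, (\<lambda>x. x (Inf (diff_set e))) ` e)"

text \<open>The palette \<open>R\<close> is a parameter because the recursion deletes colours from
  it.\<close>

definition mubayi_adj :: "(nat set \<times> 'b set) set \<Rightarrow> (nat \<Rightarrow> 'b) \<Rightarrow> (nat \<Rightarrow> 'b) \<Rightarrow> bool" where
  "mubayi_adj R x y \<longleftrightarrow> x \<noteq> y \<and> mubayi {x, y} \<in> R"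

definition lead :: "nat set \<times> 'b set \<Rightarrow> nat" where
  "lead p = Inf (fst p)"

definition colours_at :: "(nat set \<times> 'b set) set \<Rightarrow> nat \<Rightarrow> (nat set \<times> 'b set) set" where
  "colours_at R j = {p \<in> R. j \<in> fst p}"

lemma lead_in: "fst p \<noteq> {} \<Longrightarrow> lead p \<in> fst p"
  unfolding lead_def by (rule Inf_nat_def1)

lemma lead_le: "j \<in> fst p \<Longrightarrow> lead p \<le> j"
  unfolding lead_def by (simp add: wellorder_Inf_le1)

lemma fst_mubayi_iff: "j \<in> fst (mubayi {x, y}) \<longleftrightarrow> x j \<noteq> y j"
  by (auto simp: mubayi_def diff_set_def)

lemma snd_mubayi: "snd (mubayi {x, y}) = {x (lead (mubayi {x, y})), y (lead (mubayi {x, y}))}"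
  by (simp add: mubayi_def lead_def)

lemma fst_mubayi_nonempty: "x \<noteq> y \<Longrightarrow> fst (mubayi {x, y}) \<noteq> {}"
  by (auto simp: mubayi_def diff_set_def fun_eq_iff)

lemma lead_mubayi_neq:
  "x \<noteq> y \<Longrightarrow> x (lead (mubayi {x, y})) \<noteq> y (lead (mubayi {x, y}))"
  using lead_in[OF fst_mubayi_nonempty, of x y] by (simp add: fst_mubayi_iff)

section \<open>Light case: each leading coordinate lies in at most \<open>D\<close> difference
  sets\<close>

text \<open>Processing the colours by increasing leading coordinate, each new one is in conflict with
  fewer than \<open>D\<close> earlier ones.\<close>

lemma ex_class_assignment:
  assumes "finite R" "\<And>p. p \<in> R \<Longrightarrow> fst p \<noteq> {}"
    and "\<And>p. p \<in> R \<Longrightarrow> card (colours_at R (lead p)) \<le> D"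
  shows "\<exists>f :: nat set \<times> 'b set \<Rightarrow> nat. (\<forall>p\<in>R. f p < D) \<and>
    (\<forall>p\<in>R. \<forall>q\<in>R. p \<noteq> q \<longrightarrow> lead q \<in> fst p \<longrightarrow> f p \<noteq> f q)"
  using assms
proof (induction R rule: finite_ranking_induct[where f = lead])
  case empty
  then show ?case by simp
next
  case (insert q R)
  show ?case
  proof (cases "q \<in> R")
    case True
    then have "insert q R = R" by blast
    with insert.IH insert.prems show ?thesis by simp
  next
    case False
    have sub: "colours_at R j \<subseteq> colours_at (insert q R) j" for j
      by (auto simp: colours_at_def)
    have fin: "finite (colours_at (insert q R) j)" for j
      using insert.hyps by (simp add: colours_at_def)
    have "card (colours_at R (lead p)) \<le> D" if "p \<in> R" for p
      using card_mono[OF fin sub] insert.prems(2)[of p] that by (meson insertI2 le_trans)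
    then obtain f where f: "\<forall>p\<in>R. f p < D"
        "\<forall>p\<in>R. \<forall>r\<in>R. p \<noteq> r \<longrightarrow> lead r \<in> fst p \<longrightarrow> f p \<noteq> f r"
      using insert.IH insert.prems(1) by blast
    let ?N = "colours_at R (lead q)"
    have "q \<in> colours_at (insert q R) (lead q)" "q \<notin> ?N"
      using lead_in[OF insert.prems(1)[OF insertI1]] False by (simp_all add: colours_at_def)
    \<comment> \<open>The new colour \<open>q\<close> is itself one of the at most \<open>D\<close>
      colours at its leading coordinate, so the others leave some class \<open>k\<close>
      free.\<close>
    then have "card ?N < card (colours_at (insert q R) (lead q))"
      using sub[of "lead q"] by (intro psubset_card_mono fin) blast
    then have "card ?N < D" using insert.prems(2)[of q] by simp
    moreover have "finite ?N" using insert.hyps by (simp add: colours_at_def)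
    ultimately have "card (f ` ?N) < card {..<D}"
      using card_image_le[of ?N f] by simp
    then obtain k where k: "k < D" "k \<notin> f ` ?N"
      using \<open>finite ?N\<close> by (metis card_mono finite_imageI lessThan_iff linorder_not_less subsetI)
    \<comment> \<open>Conflicts in the other direction are caught by \<open>?N\<close> too: since
      \<open>q\<close> has the largest lead, \<open>lead p\<close> can lie in \<open>fst q\<close>
      only if both leads coincide.\<close>
    have earlier: "p \<in> ?N" if "p \<in> R" "lead p \<in> fst q" for p
    proof -
      have "lead p = lead q"
        using lead_le[OF that(2)] insert.hyps(2)[OF that(1)] by simp
      then show ?thesis
        using that lead_in[of p] insert.prems(1) by (auto simp: colours_at_def)
    qed
    show ?thesis
    proof (intro exI[of _ "f(q := k)"] conjI ballI impI)
      fix p assume "p \<in> insert q R"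
      then show "(f(q := k)) p < D" using f(1) k(1) by auto
    next
      fix p r assume pr: "p \<in> insert q R" "r \<in> insert q R" "p \<noteq> r" "lead r \<in> fst p"
      consider "p = q" "r \<in> R" "r \<noteq> q" | "r = q" "p \<in> R" "p \<noteq> q" | "p \<in> R" "r \<in> R" "p \<noteq> q" "r \<noteq> q"
        using pr by blast
      then show "(f(q := k)) p \<noteq> (f(q := k)) r"
      proof cases
        case 1
        then have "r \<in> ?N" using earlier pr by blast
        then show ?thesis using 1 k(2) by auto
      next
        case 2
        then have "p \<in> ?N" using pr by (simp add: colours_at_def)
        then show ?thesis using 2 k(2) by auto
      next
        case 3
        then show ?thesis using f(2) pr by auto
      qed
    qed
  qed
qed

text \<open>Within a class no leading coordinate lies in the difference set of another member, so
  along an edge of a colour from the class exactly one of the counted conditions flips.\<close>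

lemma mubayi_colouring_light:
  assumes "finite R" "\<And>p. p \<in> R \<Longrightarrow> fst p \<noteq> {}"
    and "\<And>p. p \<in> R \<Longrightarrow> card (colours_at R (lead p)) \<le> D"
  shows "\<exists>g. proper_colouring W (mubayi_adj R) (2 ^ D) g"
proof -
  obtain f :: "nat set \<times> 'a set \<Rightarrow> nat" where f: "\<forall>p\<in>R. f p < D"
      "\<forall>p\<in>R. \<forall>q\<in>R. p \<noteq> q \<longrightarrow> lead q \<in> fst p \<longrightarrow> f p \<noteq> f q"
    using ex_class_assignment[OF assms] by blast
  \<comment> \<open>An arbitrary one of the two letters of \<open>p\<close>: across an edge of
    colour \<open>p\<close>, exactly one endpoint carries it at coordinate
    \<open>lead p\<close>.\<close>
  define a where "a p = (SOME v. v \<in> snd p)" for p :: "nat set \<times> 'a set"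
  define M where "M x k = {p \<in> R. f p = k \<and> x (lead p) = a p}" for x k
  \<comment> \<open>One parity bit for each of the \<open>D\<close> classes, hence
    \<open>2 ^ D\<close> vertex colours.\<close>
  define F where "F x = {k. k < D \<and> odd (card (M x k))}" for x
  have fin: "finite (M x k)" for x k using assms(1) by (simp add: M_def)
  show ?thesis
  proof (rule proper_colouringI_card)
    show "finite (Pow {..<D})" "card (Pow {..<D}) \<le> 2 ^ D" by (simp_all add: card_Pow)
    show "F ` W \<subseteq> Pow {..<D}" by (auto simp: F_def)
  next
    fix x y assume "mubayi_adj R x y"
    define p where "p = mubayi {x, y}"
    have p: "p \<in> R" "x \<noteq> y" using \<open>mubayi_adj R x y\<close> by (auto simp: mubayi_adj_def p_def)
    have neq: "x (lead p) \<noteq> y (lead p)" using lead_mubayi_neq p(2) by (simp add: p_def)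
    have "snd p \<noteq> {}" by (simp add: p_def snd_mubayi)
    then have "a p \<in> snd p" unfolding a_def by (simp add: some_in_eq)
    then have a: "a p = x (lead p) \<or> a p = y (lead p)"
      using snd_mubayi[of x y] by (auto simp: p_def)
    have same: "q \<in> M x (f p) \<longleftrightarrow> q \<in> M y (f p)" if "q \<noteq> p" for q
    proof -
      have "x (lead q) = y (lead q)" if "q \<in> R" "f q = f p"
        using f(2) that \<open>q \<noteq> p\<close> p(1) fst_mubayi_iff[of "lead q" x y] unfolding p_def by metis
      then show ?thesis by (auto simp: M_def)
    qed
    have "M x (f p) = insert p (M y (f p)) \<and> p \<notin> M y (f p) \<or>
          M y (f p) = insert p (M x (f p)) \<and> p \<notin> M x (f p)"
      using a
    proof
      assume "a p = x (lead p)"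
      then have mem: "p \<in> M x (f p)" "p \<notin> M y (f p)" using neq p by (auto simp: M_def)
      have "q \<in> M x (f p) \<longleftrightarrow> q \<in> insert p (M y (f p))" for q
        using same[of q] mem by (cases "q = p") simp_all
      then show ?thesis using mem by blast
    next
      assume "a p = y (lead p)"
      then have mem: "p \<in> M y (f p)" "p \<notin> M x (f p)" using neq p by (auto simp: M_def)
      have "q \<in> M y (f p) \<longleftrightarrow> q \<in> insert p (M x (f p))" for q
        using same[of q] mem by (cases "q = p") simp_all
      then show ?thesis using mem by blast
    qed
    then have "odd (card (M x (f p))) \<noteq> odd (card (M y (f p)))"
      using fin by (metis card_insert_disjoint even_Suc)
    moreover have "f p < D" using f(1) p(1) by blast
    ultimately show "F x \<noteq> F y" unfolding F_def by blast
  qed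
qed

section \<open>Recursion on heavy coordinates\<close>

text \<open>Two vertices agreeing in coordinate \<open>j\<close> are joined by no colour whose difference set contains
  \<open>j\<close>. Fixing a heavy coordinate of a vertex to a value therefore removes more than \<open>D\<close> colours.\<close>

lemma mubayi_colouring:
  fixes W :: "(nat \<Rightarrow> 'b) set"
  assumes "finite R" "\<And>p. p \<in> R \<Longrightarrow> fst p \<noteq> {} \<and> card (snd p) = 2" "card R \<le> r" "r \<le> s"
  shows "\<exists>g. proper_colouring W (mubayi_adj R) ((2 * s + 1) ^ (r div (D + 1)) * 2 ^ D) g"
  using assms
\<comment> \<open>Only \<open>r\<close> shrinks; \<open>s\<close> stays fixed through the recursion,
  so every level costs the same factor \<open>2 * s + 1\<close>.\<close>
proof (induction r arbitrary: R W rule: less_induct)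
  case (less r)
  define L where "L = (\<Union>p\<in>R. {lead p} \<times> snd p)"
  define H where "H = {h \<in> L. card (colours_at R (fst h)) > D}"
  let ?B = "(2 * s + 1) ^ (r div (D + 1)) * 2 ^ D"
  have finL: "finite L"
    unfolding L_def using less.prems(1,2)
    by (intro finite_UN_I finite_cartesian_product) (auto intro: card_ge_0_finite)
  have "card L \<le> (\<Sum>p\<in>R. card ({lead p} \<times> snd p))"
    unfolding L_def by (rule card_UN_le) (rule less.prems)
  also have "\<dots> = (\<Sum>p\<in>R. 2)"
    using less.prems(2) by (intro sum.cong) (simp_all add: card_cartesian_product)
  finally have "card L \<le> 2 * s" using less.prems(3,4) by simp
  moreover have "H \<subseteq> L" by (auto simp: H_def)
  ultimately have cardH: "card H \<le> 2 * s" and finH: "finite H"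
    using card_mono[OF finL] finite_subset[OF _ finL] le_trans by blast+
  define sat where "sat x h \<longleftrightarrow> h \<in> H \<and> x (fst h) = snd h" for x :: "nat \<Rightarrow> 'b" and h
  \<comment> \<open>A vertex may satisfy several heavy pairs; any choice works, since only the pair
    shared by two vertices of one part is used.\<close>
  define g where "g x = (if \<exists>h. sat x h then Some (SOME h. sat x h) else None)" for x
  have g_Some: "sat x h" if "g x = Some h" for x h
    using that someI_ex[of "sat x"] by (auto simp: g_def split: if_splits)
  have g_None: "\<not> sat x h" if "g x = None" for x h
    using that unfolding g_def by (metis option.distinct(1))
  \<comment> \<open>These colours suffice for the vertices with \<open>g x = None\<close>: an edge
    with a heavy leading coordinate would make both endpoints satisfy a pair in
    \<open>H\<close>.\<close>
  define R0 where "R0 = {p \<in> R. card (colours_at R (lead p)) \<le> D}"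
  have fin_at: "finite (colours_at R j)" for j
    using less.prems(1) by (simp add: colours_at_def)
  have light: "\<exists>f. proper_colouring W (mubayi_adj R0) (2 ^ D) f"
  proof (rule mubayi_colouring_light)
    fix p assume "p \<in> R0"
    moreover have "card (colours_at R0 (lead p)) \<le> card (colours_at R (lead p))"
      by (intro card_mono fin_at) (auto simp: colours_at_def R0_def)
    ultimately show "card (colours_at R0 (lead p)) \<le> D" by (simp add: R0_def)
  qed (use less.prems in \<open>auto simp: R0_def\<close>)
  show ?case
  proof (cases "H = {}")
    case True
    have "p \<in> R0" if "p \<in> R" for p
    proof -
      have "snd p \<noteq> {}" using less.prems(2)[OF that] by auto
      then obtain v where "v \<in> snd p" by blast
      then have "(lead p, v) \<in> L" using that unfolding L_def by blast
      then show ?thesis using True that by (auto simp: H_def R0_def)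
    qed
    then have "R0 = R" by (auto simp: R0_def)
    then obtain f where f: "proper_colouring W (mubayi_adj R) (2 ^ D) f" using light by blast
    have "2 ^ D \<le> ?B" by simp
    with f show ?thesis unfolding proper_colouring_def by (meson less_le_trans)
  next
    case False
    then obtain h0 where "h0 \<in> H" by blast
    then have "D < card (colours_at R (fst h0))" by (simp add: H_def)
    also have "\<dots> \<le> card R" by (intro card_mono less.prems) (auto simp: colours_at_def)
    finally have Dr: "D + 1 \<le> r" using less.prems(3) by simp
    define r' where "r' = r - (D + 1)"
    let ?B' = "(2 * s + 1) ^ (r' div (D + 1)) * 2 ^ D"
    \<comment> \<open>Lowering \<open>r\<close> by \<open>D + 1\<close> lowers the quotient by
      exactly one, which pays for the factor \<open>2 * s + 1\<close> of this level.\<close>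
    have rdiv: "r div (D + 1) = Suc (r' div (D + 1))"
      using Dr by (simp add: r'_def le_div_geq)
    have heavy: "\<exists>f. proper_colouring W (mubayi_adj (R - colours_at R (fst h))) ?B' f" if "h \<in> H" for h
    proof (rule less.IH)
      show "r' < r" "r' \<le> s" using Dr less.prems(4) by (auto simp: r'_def)
      have "card (R - colours_at R (fst h)) = card R - card (colours_at R (fst h))"
        by (intro card_Diff_subset fin_at) (auto simp: colours_at_def)
      moreover have "D < card (colours_at R (fst h))" using that by (simp add: H_def)
      ultimately show "card (R - colours_at R (fst h)) \<le> r'" using less.prems(3) by (simp add: r'_def)
    qed (use less.prems in auto)
    then obtain fh where fh:
      "\<And>h. h \<in> H \<Longrightarrow> proper_colouring W (mubayi_adj (R - colours_at R (fst h))) ?B' (fh h)"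
      by metis
    obtain f0 where f0: "proper_colouring W (mubayi_adj R0) (2 ^ D) f0" using light by blast
    \<comment> \<open>The tag \<open>g x\<close> separates the parts. The part tagged
      \<open>None\<close> also fits below \<open>?B'\<close>, as \<open>2 ^ D\<close> is at most
      \<open>?B'\<close>.\<close>
    define F where "F x = (g x, case g x of None \<Rightarrow> f0 x | Some h \<Rightarrow> fh h x)" for x
    let ?C = "insert None (Some ` H) \<times> {..<?B'}"
    show ?thesis
    proof (rule proper_colouringI_card)
      show "finite ?C" using finH by simp
      have "card (insert None (Some ` H)) \<le> 2 * s + 1"
        using cardH card_image_le[OF finH, of Some]
          card_insert_le_m1[of "2 * s + 1" "Some ` H" None] by simp
      then have "card ?C \<le> (2 * s + 1) * ?B'"
        by (simp only: card_cartesian_product card_lessThan mult_le_mono1)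
      then show "card ?C \<le> ?B" unfolding rdiv power_Suc mult.assoc .
      have le: "2 ^ D \<le> ?B'" by simp
      show "F ` W \<subseteq> ?C"
      proof (rule image_subsetI)
        fix x assume x: "x \<in> W"
        show "F x \<in> ?C"
        proof (cases "g x")
          case None
          moreover have "f0 x < ?B'"
            using f0 x le unfolding proper_colouring_def by (meson less_le_trans)
          ultimately show ?thesis by (simp add: F_def)
        next
          case (Some h)
          then have "h \<in> H" using g_Some by (auto simp: sat_def)
          then show ?thesis using fh x Some by (simp add: F_def proper_colouring_def)
        qed
      qed
    next
      fix x y assume xy: "x \<in> W" "y \<in> W" "mubayi_adj R x y"
      let ?p = "mubayi {x, y}"
      show "F x \<noteq> F y"
      proof
        assume eq: "F x = F y"
        then have gxy: "g x = g y" by (simp add: F_def)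
        show False
        proof (cases "g x")
          case None
          have "?p \<in> R" using xy(3) by (simp add: mubayi_adj_def)
          moreover have "x (lead ?p) \<in> snd ?p" by (simp add: snd_mubayi)
          ultimately have "(lead ?p, x (lead ?p)) \<in> L" unfolding L_def by blast
          then have "?p \<in> R0" using g_None[OF None, of "(lead ?p, x (lead ?p))"] \<open>?p \<in> R\<close>
            by (auto simp: sat_def H_def R0_def)
          then have "f0 x \<noteq> f0 y"
            using f0 xy by (simp add: proper_colouring_def mubayi_adj_def)
          then show False using eq None gxy by (simp add: F_def)
        next
          case (Some h)
          have sat: "sat x h" "sat y h" using g_Some Some gxy by auto
          then have "?p \<notin> colours_at R (fst h)"
            by (simp add: sat_def colours_at_def fst_mubayi_iff)
          then have "mubayi_adj (R - colours_at R (fst h)) x y"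
            using xy(3) by (simp add: mubayi_adj_def)
          then have "fh h x \<noteq> fh h y"
            using fh[of h] sat(1) xy by (simp add: proper_colouring_def sat_def)
          moreover have "g y = Some h" using Some gxy by simp
          ultimately show False using eq Some by (simp add: F_def)
        qed
      qed
    qed
  qed
qed

section \<open>The numerical bound on the number of vertex colours\<close>

lemma bound_le_powr:
  fixes s :: nat
  assumes "s \<ge> 2"
  defines "Q \<equiv> sqrt (real s * log 2 (real s))"
  defines "D \<equiv> nat \<lfloor>Q\<rfloor>"
  shows "real ((2 * s + 1) ^ (s div (D + 1)) * 2 ^ D) \<le> 2 powr (3 * Q)"
proof -
  have lg: "log 2 (real s) \<ge> 1" using assms(1) by (simp add: le_log_iff)
  then have pos: "real s * log 2 (real s) > 0" using assms(1) by simp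
  then have Q: "Q > 0" "Q * Q = real s * log 2 (real s)" by (simp_all add: Q_def)
  have D: "real D \<le> Q" "Q < real D + 1" using Q by (auto simp: D_def)
  define K where "K = s div (D + 1)"
  have "real K * Q \<le> real K * (real D + 1)" using D by (intro mult_left_mono) auto
  also have "\<dots> = real (K * (D + 1))" by (simp add: algebra_simps)
  also have "\<dots> \<le> real s" unfolding K_def using div_times_less_eq_dividend of_nat_le_iff by blast
  finally have KQ: "real K * Q \<le> real s" .
  \<comment> \<open>Since \<open>K\<close> is at most \<open>s / Q\<close>, the estimate
    \<open>2 * s + 1 <= s ^ 2\<close> bounds the left side by
    \<open>2 * s * log 2 s / Q = 2 * Q\<close>; the factor \<open>2 ^ D\<close> adds at most one
    more \<open>Q\<close>. The estimate fails at \<open>s = 2\<close>, where \<open>K = 1\<close>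
    and \<open>log 2 5 <= 5/2 <= 2 * sqrt 2\<close>.\<close>
  have main: "real K * log 2 (real (2 * s + 1)) \<le> 2 * Q"
  proof (cases "s = 2")
    case True
    then have "Q = sqrt 2" by (simp add: Q_def)
    then have "D = 1" using sqrt2_less_2 by (simp add: D_def) (simp add: floor_eq_iff nat_eq_iff)
    then have "K = 1" using True by (simp add: K_def numeral_2_eq_2)
    have "log 2 (5::real) \<le> 5/2"
    proof -
      have "(5::real) ^ 2 \<le> 2 ^ 5" by simp
      then have "log 2 ((5::real) ^ 2) \<le> log 2 (2 ^ 5)" by (subst log_le_cancel_iff) auto
      then have "real 2 * log 2 (5::real) \<le> real 5 * log 2 2"
        by (subst (asm) (1 2) log_nat_power) auto
      then show ?thesis by simp
    qed
    moreover have "5/4 \<le> sqrt (2::real)" by (rule real_le_rsqrt) (simp add: power2_eq_square)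
    ultimately show ?thesis using True \<open>K = 1\<close> \<open>Q = sqrt 2\<close> by simp
  next
    case False
    then have "s \<ge> 3" using assms(1) by simp
    then have "3 * s \<le> s ^ 2" by (simp add: power2_eq_square)
    then have "2 * s + 1 \<le> s ^ 2" using \<open>s \<ge> 3\<close> by linarith
    then have "real (2 * s + 1) \<le> real s ^ 2" by (metis of_nat_le_iff of_nat_power)
    then have "log 2 (real (2 * s + 1)) \<le> log 2 (real s ^ 2)"
      using \<open>s \<ge> 3\<close> by (subst log_le_cancel_iff) auto
    also have "\<dots> = 2 * log 2 (real s)" using \<open>s \<ge> 3\<close> by (simp add: log_nat_power)
    finally have "real K * log 2 (real (2 * s + 1)) \<le> real K * (2 * log 2 (real s))"
      by (intro mult_left_mono) auto
    also have "\<dots> \<le> 2 * Q"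
    proof -
      have "real K * Q * log 2 (real s) \<le> real s * log 2 (real s)"
        using KQ lg by (intro mult_right_mono) auto
      then have "(real K * log 2 (real s)) * Q \<le> Q * Q" by (simp add: Q(2) mult_ac)
      then show ?thesis using Q(1) by simp
    qed
    finally show ?thesis .
  qed
  have "real ((2 * s + 1) ^ K * 2 ^ D) = 2 powr (real K * log 2 (real (2 * s + 1))) * 2 powr real D"
  proof -
    have "(2::real) powr (real K * log 2 (real (2 * s + 1))) = real (2 * s + 1) ^ K"
      by (subst mult.commute, subst powr_powr[symmetric], subst powr_log_cancel) (auto simp: powr_realpow)
    then show ?thesis by (simp add: powr_realpow)
  qed
  also have "\<dots> = 2 powr (real K * log 2 (real (2 * s + 1)) + real D)" by (simp add: powr_add)
  also have "\<dots> \<le> 2 powr (3 * Q)" using main D by simp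
  finally show ?thesis by (simp add: K_def)
qed

section \<open>Coding vertices and colours, and the final assembly\<close>

theorem theorem1p7:
  fixes n :: nat
  assumes "n \<ge> 1"
  shows "\<exists>c :: nat set \<Rightarrow> nat.
           (\<forall>u<n. \<forall>v<n. u \<noteq> v \<longrightarrow>
               c {u, v} < nat \<lceil>2 powr (6 * sqrt (log 2 (real n)))\<rceil>) \<and>
           (\<forall>X :: nat set. X \<subseteq> {..< nat \<lceil>2 powr (6 * sqrt (log 2 (real n)))\<rceil>} \<longrightarrow>
               card X \<ge> 2 \<longrightarrow>
               real (chromatic_number {..<n} (\<lambda>u v. u \<noteq> v \<and> c {u, v} \<in> X))
                 \<le> 2 powr (3 * sqrt (real (card X) * log 2 (real (card X)))))"
proof -
  let ?N = "nat \<lceil>2 powr (6 * sqrt (log 2 (real n)))\<rceil>"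
  define l where "l = sqrt (log 2 (real n))"
  define t where "t = nat \<lceil>l\<rceil>"
  have log_n: "log 2 (real n) \<ge> 0" using assms by simp
  then have l0: "l \<ge> 0" by (simp add: l_def)
  have t: "real t \<ge> l" using l0 by (simp add: t_def)
  have "n \<le> 2 ^ (t * t)"
  proof -
    have "real n = 2 powr (l * l)" using assms log_n by (simp add: l_def)
    also have "\<dots> \<le> 2 powr (real t * real t)" using t l0 by (simp add: mult_mono)
    also have "\<dots> = real (2 ^ (t * t))" by (simp flip: powr_realpow)
    finally show ?thesis using of_nat_le_iff by blast
  qed
  \<comment> \<open>Extensional functions all agree outside \<open>{..<t}\<close>, which keeps the
    difference sets inside \<open>{..<t}\<close>.\<close>
  let ?V = "{..<t} \<rightarrow>\<^sub>E {..<2 ^ t :: nat}"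
  have "card ?V = 2 ^ (t * t)" by (simp add: card_PiE power_mult)
  moreover have finV: "finite ?V" by (simp add: finite_PiE)
  ultimately obtain dig where dig: "dig ` {..<n} \<subseteq> ?V" "inj_on dig {..<n}"
    using card_le_inj[of "{..<n}" ?V] \<open>n \<le> 2 ^ (t * t)\<close> by auto
  let ?P = "{A. A \<subseteq> {..<2 ^ t :: nat} \<and> card A = 2}"
  \<comment> \<open>Nonempty difference sets and letter pairs of size two are what
    \<open>mubayi_colouring\<close> asks of a palette.\<close>
  let ?C = "(Pow {..<t} - {{}}) \<times> ?P"
  have "card ?P \<le> (2 ^ t) ^ 2"
    using binomial_fact_pow[of "2 ^ t" 2] by (simp add: n_subsets)
  have finC: "finite ?C" by simp
  have "card ?C \<le> 2 ^ t * (2 ^ t) ^ 2"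
    unfolding card_cartesian_product
    by (intro mult_mono \<open>card ?P \<le> (2 ^ t) ^ 2\<close>) (simp_all add: card_Diff_subset card_Pow)
  also have "\<dots> = 2 ^ (3 * t)" by (simp flip: power_mult power_add)
  finally have cardC: "card ?C \<le> 2 ^ (3 * t)" .
  \<comment> \<open>Source of the constant 6: rounding \<open>l\<close> up at most doubles it,
    because \<open>l\<close> is 0 or at least 1, so \<open>3 * t\<close> is at most
    \<open>6 * l\<close>.\<close>
  have "real t \<le> 2 * l"
  proof (cases "n = 1")
    case True
    then show ?thesis by (simp add: t_def l_def)
  next
    case False
    then have "log 2 (real n) \<ge> 1" using assms by (simp add: le_log_iff)
    then have "l \<ge> 1" by (simp add: l_def)
    then show ?thesis unfolding t_def by linarith
  qed
  then have "2 powr (real (3 * t)) \<le> 2 powr (6 * l)" by simp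
  then have "real (2 ^ (3 * t)) \<le> 2 powr (6 * l)" by (simp flip: powr_realpow)
  then have "2 ^ (3 * t) \<le> ?N" unfolding l_def by linarith
  with cardC have "card ?C \<le> card {..<?N}" unfolding card_lessThan by (rule le_trans)
  then obtain enc where enc: "enc ` ?C \<subseteq> {..<?N}" "inj_on enc ?C"
    using card_le_inj[OF finC finite_lessThan] by blast
  define c where "c e = enc (mubayi (dig ` e))" for e
  have mem: "mubayi {dig u, dig v} \<in> ?C" if "u < n" "v < n" "u \<noteq> v" for u v
  proof -
    let ?p = "mubayi {dig u, dig v}"
    have V: "dig u \<in> ?V" "dig v \<in> ?V" using dig(1) that by auto
    have neq: "dig u \<noteq> dig v" using dig(2) that by (auto dest: inj_onD)
    have "j < t" if "j \<in> fst ?p" for j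
    proof (rule ccontr)
      assume "\<not> j < t"
      then show False using that PiE_arb[OF V(1), of j] PiE_arb[OF V(2), of j] by (simp add: fst_mubayi_iff)
    qed
    then have 1: "fst ?p \<subseteq> {..<t}" by auto
    have "lead ?p < t" using 1 lead_in[OF fst_mubayi_nonempty[OF neq]] by auto
    then have 2: "snd ?p \<subseteq> {..<2 ^ t}" unfolding snd_mubayi using V by (auto simp: PiE_iff)
    have 3: "card (snd ?p) = 2" unfolding snd_mubayi using lead_mubayi_neq[OF neq] by simp
    show ?thesis using 1 2 3 fst_mubayi_nonempty[OF neq] by (simp add: mem_Times_iff)
  qed
  show ?thesis
  proof (intro exI[of _ c] conjI allI impI)
    fix u v assume "u < n" "v < n" "u \<noteq> v"
    then have "enc (mubayi {dig u, dig v}) \<in> {..<?N}" using mem enc(1) by blast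
    then show "c {u, v} < ?N" by (simp add: c_def)
  next
    fix X :: "nat set" assume X: "X \<subseteq> {..<?N}" "card X \<ge> 2"
    let ?s = "card X"
    let ?Q = "sqrt (real ?s * log 2 (real ?s))"
    define D where "D = nat \<lfloor>?Q\<rfloor>"
    \<comment> \<open>The preimage of \<open>X\<close> under the injection \<open>enc\<close>, hence
      no larger than \<open>X\<close>; members of \<open>X\<close> outside the image of
      \<open>enc\<close> colour no edge.\<close>
    define R where "R = {p \<in> ?C. enc p \<in> X}"
    have "finite X" using X(1) finite_subset by blast
    have "finite R" using finC by (simp add: R_def)
    have "inj_on enc R" using enc(2) by (rule inj_on_subset) (auto simp: R_def)
    then have "card R \<le> ?s"
      using \<open>finite X\<close> by (intro card_inj_on_le[of enc]) (auto simp: R_def)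
    then obtain g where g:
      "proper_colouring (dig ` {..<n}) (mubayi_adj R) ((2 * ?s + 1) ^ (?s div (D + 1)) * 2 ^ D) g"
      using mubayi_colouring[OF \<open>finite R\<close>, of ?s ?s "dig ` {..<n}" D] by (auto simp: R_def)
    have "mubayi_adj R (dig u) (dig v)" if "u < n" "v < n" "u \<noteq> v" "c {u, v} \<in> X" for u v
      using that mem[OF that(1-3)] dig(2) by (auto simp: mubayi_adj_def R_def c_def dest: inj_onD)
    then have "proper_colouring {..<n} (\<lambda>u v. u \<noteq> v \<and> c {u, v} \<in> X)
        ((2 * ?s + 1) ^ (?s div (D + 1)) * 2 ^ D) (g \<circ> dig)"
      using g unfolding proper_colouring_def by auto
    then have "real (chromatic_number {..<n} (\<lambda>u v. u \<noteq> v \<and> c {u, v} \<in> X))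
        \<le> real ((2 * ?s + 1) ^ (?s div (D + 1)) * 2 ^ D)"
      by (intro of_nat_mono chromatic_number_le)
    also have "\<dots> \<le> 2 powr (3 * ?Q)"
      unfolding D_def by (rule bound_le_powr[OF X(2)])
    finally show "real (chromatic_number {..<n} (\<lambda>u v. u \<noteq> v \<and> c {u, v} \<in> X)) \<le> 2 powr (3 * ?Q)" .
  qed
qed

end
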